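(* Consider the finite difference scheme below with the FIDR operators $\mathbb{D}_t^{\alpha}$ and $\mathbb{D}_t^{\alpha/2}$, and let $\{u_i^k: 0\le i\le N_S,\ 0\le k\le N_T\}$ be a solution of it for given data $f_i^k$ and initial values $u_i^0$. Then for every $1\le n\le N_T$, $$\Delta t\sum_{k=1}^n\|u^k\|_\infty^2\le\frac{2(1+\sqrt{1+L^2\tilde\mu})}{L\tilde\mu}\Big(\tilde\rho\|u^0\|^2+\tilde\varrho[(u_0^0)^2+(u_{N_S}^0)^2]+\frac{\Delta t}{8\tilde\nu}\sum_{k=1}^n[(hf_0^k)^2+(hf_{N_S}^k)^2]+\frac{\Delta t}{\tilde\mu}\sum_{k=1}^nh\sum_{i=1}^{N_S-1}(f_i^k)^2\Big),$$ where $\tilde\rho=\frac{\Delta t^{1-\alpha}(1-\alpha)^{-1}+t_{n-1}\Delta t^{-\alpha}}{2\Gamma(1-\alpha)}$, $\tilde\varrho=\frac{\Delta t^{1-\alpha/2}(1-\frac\alpha2)^{-1}+t_{n-1}\Delta t^{-\alpha/2}}{2\Gamma(1-\frac\alpha2)}$, $\tilde\mu=\frac{t_n^{-\alpha}-\varepsilon_0}{\Gamma(1-\alpha)}$, $\tilde\nu=\frac{t_n^{-\alpha/2}-\varepsilon_0}{\Gamma(1-\frac\alpha2)}$.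
   Context: Let $0<\alpha<1$, $x_l<x_r$, $L=x_r-x_l$, $T>0$, $N_T,N_S$ positive integers, $\Delta t=T/N_T$, $t_k=k\Delta t$, $h=(x_r-x_l)/N_S$, $x_i=x_l+ih$. For a grid vector $v=(v_0,\dots,v_{N_S})$: $\delta_xv_{i+1/2}=(v_{i+1}-v_i)/h$, $\delta_x^2v_i=(\delta_xv_{i+1/2}-\delta_xv_{i-1/2})/h$; $(v,w)=h\big[\tfrac12v_0w_0+\sum_{i=1}^{N_S-1}v_iw_i+\tfrac12v_{N_S}w_{N_S}\big]$, $\|v\|^2=(v,v)$, $\|\delta_xv\|^2=h\sum_{i=1}^{N_S}(\delta_xv_{i-1/2})^2$, $\|v\|_\infty=\max_i|v_i|$. For $\beta\in\{\alpha,\alpha/2\}$ let $\tilde s_i^{(\beta)}>0,\tilde w_i^{(\beta)}>0$ ($i=1,\dots,N_A$) satisfy $|t^{-\beta}-\sum_i\tilde w_i^{(\beta)}e^{-\tilde s_i^{(\beta)}t}|\le\varepsilon_0$ for all $t\in[\Delta t,T]$. The FIDR operator acts on a time sequence $(g^k)_{k\ge0}$ by $$\mathbb{D}_t^\beta g^n=\frac{g^n-g^{n-1}}{\Delta t^\beta\Gamma(2-\beta)}+\frac{1}{\Gamma(1-\beta)}\sum_i\tilde w_i^{(\beta)}\tilde\Psi_i^n,$$ with $\tilde\Psi_i^1=0$ and for $n\ge2$, writing $s=\tilde s_i^{(\beta)}$, $\tilde\Psi_i^n=e^{-s\Delta t}\tilde\Psi_i^{n-1}+\frac{(g^{n-1}-g^{n-2})(1-e^{-s\Delta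 t})e^{-s\Delta t}}{s\Delta t}$; it is applied at each fixed spatial index $i$ to $k\mapsto u_i^k$. The scheme is: $\mathbb{D}_t^\alpha u_i^n=\delta_x^2u_i^n+f_i^n$ for $1\le i\le N_S-1$, $1\le n\le N_T$; $\mathbb{D}_t^\alpha u_0^n=\frac2h[\delta_xu_{1/2}^n-\mathbb{D}_t^{\alpha/2}u_0^n]+f_0^n$; $\mathbb{D}_t^\alpha u_{N_S}^n=\frac2h[-\delta_xu_{N_S-1/2}^n-\mathbb{D}_t^{\alpha/2}u_{N_S}^n]+f_{N_S}^n$ for $1\le n\le N_T$.
   Formalization: The formal theorem additionally assumes μ̃ > 0 and ν̃ > 0 (ε₀ smaller than t_n^{-α} and t_n^{-α/2}); without this the right-hand side can be undefined or negative (e.g. f = 0, u⁰ ≠ 0, μ̃ slightly negative), so the estimate fails. *)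

theory Defs
  imports "HOL-Analysis.Analysis"
begin

text \<open>History term of the FIDR operator. Arguments: exponent s, time step dt,
  time sequence g, time level n.  Psi^0 = Psi^1 = 0 (Psi^0 unused).\<close>
fun fidr_Psi :: "real \<Rightarrow> real \<Rightarrow> (nat \<Rightarrow> real) \<Rightarrow> nat \<Rightarrow> real" where
  "fidr_Psi s dt g 0 = 0"
| "fidr_Psi s dt g (Suc 0) = 0"
| "fidr_Psi s dt g (Suc (Suc m)) =
     exp (- s * dt) * fidr_Psi s dt g (Suc m)
     + (g (Suc m) - g m) * (1 - exp (- s * dt)) * exp (- s * dt) / (s * dt)"

definition fidr :: "real \<Rightarrow> real \<Rightarrow> nat \<Rightarrow> (nat \<Rightarrow> real) \<Rightarrow> (nat \<Rightarrow> real)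
                    \<Rightarrow> (nat \<Rightarrow> real) \<Rightarrow> nat \<Rightarrow> real" where
  "fidr beta dt NA w s g n =
     (g n - g (n - 1)) / (dt powr beta * Gamma (2 - beta))
     + (1 / Gamma (1 - beta)) * (\<Sum>i = 1..NA. w i * fidr_Psi (s i) dt g n)"

text \<open>Discrete trapezoidal L2 norm squared of a grid vector v_0..v_NS.\<close>
definition grid_norm2 :: "real \<Rightarrow> nat \<Rightarrow> (nat \<Rightarrow> real) \<Rightarrow> real" where
  "grid_norm2 h NS v =
     h * ((1/2) * (v 0)^2 + (\<Sum>i = 1..NS - 1. (v i)^2) + (1/2) * (v NS)^2)"

definition grid_max_norm :: "nat \<Rightarrow> (nat \<Rightarrow> real) \<Rightarrow> real" where
  "grid_max_norm NS v = Max ((\<lambda>i. \<bar>v i\<bar>) ` {0..NS})"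

end

theory Submission
  imports Defs
begin

text \<open>
  Energy method: test the scheme at each level with \<open>u\<^sup>k\<close> in the trapezoidal inner product,
  sum over the levels, absorb the source terms by Young's inequality, and finish with a discrete
  Sobolev inequality whose parameter balances \<open>\<parallel>\<delta>\<^sub>x u\<parallel>\<^sup>2\<close> against \<open>\<mu>/4 \<parallel>u\<parallel>\<^sup>2\<close>.

  The core is the coercivity of the FIDR operator. Its convolution kernel \<open>b\<^sub>0, b\<^sub>1, b\<^sub>2, \<dots>\<close> need not
  be decreasing (\<open>b\<^sub>1 > b\<^sub>0\<close> is possible when \<open>\<epsilon>0\<close> is not small), so the classical argument for L1-type
  kernels does not apply directly. For one exponential with ratio \<open>p\<close>, however, the history term is,
  up to a multiple of the increment of \<open>g\<close>, a positive multiple of \<open>(G\<^sub>k + G\<^sub>k\<^sub>-\<^sub>1)/2\<close>, where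
  \<open>G\<^sub>k = p G\<^sub>k\<^sub>-\<^sub>1 + g\<^sub>k - g\<^sub>k\<^sub>-\<^sub>1\<close>. Write \<open>g\<^sub>k\<close> as the half-step value
  \<open>(g\<^sub>k + g\<^sub>k\<^sub>-\<^sub>1)/2\<close> plus half the increment. The increment part tested against this memory is
  nonnegative, and on half-step values the memory acts through a decreasing kernel
  \<open>\<kappa>\<^sub>0 \<ge> \<kappa>\<^sub>1 \<ge> \<dots>\<close>, to which the classical argument applies. The initial-value terms are
  absorbed by treating the levels \<open>k\<close> and \<open>n + 1 - k\<close> together.
\<close>

section \<open>Exponential memory and half-step values\<close>

primrec exp_memory :: "real \<Rightarrow> (nat \<Rightarrow> real) \<Rightarrow> nat \<Rightarrow> real" where
  "exp_memory p g 0 = 0"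
| "exp_memory p g (Suc k) = p * exp_memory p g k + (g (Suc k) - g k)"

text \<open>The history lags by one level: at \<open>Suc k\<close> it sees increments only up to
  level \<open>k\<close>, hence the memory index \<open>k\<close>.\<close>

lemma fidr_Psi_Suc_eq:
  "fidr_Psi s dt g (Suc k)
    = (1 - exp (- s * dt)) * exp (- s * dt) / (s * dt) * exp_memory (exp (- s * dt)) g k"
proof (induction k)
  case (Suc k)
  show ?case
    unfolding fidr_Psi.simps Suc.IH by (simp add: algebra_simps add_divide_distrib diff_divide_distrib)
qed simp

lemma exp_memory_eq_sum:
  "exp_memory p g (Suc k) = (\<Sum>j\<le>k. p ^ (k - j) * (g (Suc j) - g j))"
proof (induction k)
  case (Suc k)
  have "(\<Sum>j\<le>k. p ^ (Suc k - j) * (g (Suc j) - g j))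
      = p * (\<Sum>j\<le>k. p ^ (k - j) * (g (Suc j) - g j))"
    unfolding sum_distrib_left by (rule sum.cong) (auto simp: Suc_diff_le)
  then show ?case
    using Suc by simp
qed simp

text \<open>The value at \<open>0\<close> corresponds to \<open>g\<close> being constant before time \<open>0\<close>, so that averaging
  commutes with \<^const>\<open>exp_memory\<close> also at the first step.\<close>
definition half_step :: "(nat \<Rightarrow> real) \<Rightarrow> nat \<Rightarrow> real" where
  "half_step g k = (if k = 0 then g 0 else (g k + g (k - 1)) / 2)"

lemma exp_memory_half_step:
  "exp_memory p (half_step g) (Suc k) = (exp_memory p g (Suc k) + exp_memory p g k) / 2"
proof (induction k)
  case 0
  then show ?case by (simp add: half_step_def field_simps)
next
  case (Suc k)
  have "exp_memory p (half_step g) (Suc (Suc k))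
      = p * exp_memory p (half_step g) (Suc k) + (half_step g (Suc (Suc k)) - half_step g (Suc k))"
    by simp
  moreover have "half_step g (Suc (Suc k)) - half_step g (Suc k)
      = ((g (Suc (Suc k)) - g (Suc k)) + (exp_memory p g (Suc k) - p * exp_memory p g k)) / 2"
    by (cases k) (simp_all add: half_step_def field_simps)
  ultimately show ?case
    unfolding Suc by (simp add: field_simps)
qed

text \<open>With G = p H + d one has d (G + H) = (1 + p)/2 (G^2 - H^2) + (1 - p)/2 (G + H)^2, a
  telescoping part plus a nonnegative square.\<close>

lemma sum_increment_exp_memory_nonneg:
  assumes "0 \<le> p" "p \<le> 1"
  shows "0 \<le> (\<Sum>k<n. (g (Suc k) - g k) * (exp_memory p g (Suc k) + exp_memory p g k))"
proof -
  have "(1 + p) / 2 * (exp_memory p g n)\<^sup>2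
      \<le> (\<Sum>k<n. (g (Suc k) - g k) * (exp_memory p g (Suc k) + exp_memory p g k))"
  proof (induction n)
    case (Suc n)
    let ?H = "exp_memory p g n" and ?G = "exp_memory p g (Suc n)"
    have "(g (Suc n) - g n) * (?G + ?H)
        = (1 + p) / 2 * (?G\<^sup>2 - ?H\<^sup>2) + (1 - p) / 2 * (?G + ?H)\<^sup>2"
      by (simp add: field_simps power2_eq_square)
    moreover have "0 \<le> (1 - p) / 2 * (?G + ?H)\<^sup>2"
      using assms by simp
    ultimately have "(1 + p) / 2 * (?G\<^sup>2 - ?H\<^sup>2) \<le> (g (Suc n) - g n) * (?G + ?H)"
      by linarith
    with Suc show ?case
      by (simp add: right_diff_distrib del: exp_memory.simps)
  qed simp
  moreover have "0 \<le> (1 + p) / 2 * (exp_memory p g n)\<^sup>2"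
    using assms by simp
  ultimately show ?thesis by linarith
qed

section \<open>Convolutions with decreasing kernels\<close>

lemma convolution_increment_by_parts:
  fixes c g :: "nat \<Rightarrow> real"
  shows "(\<Sum>j\<le>m. c (m - j) * (g (Suc j) - g j))
    = c 0 * g (Suc m) - c m * g 0 - (\<Sum>j<m. (c (m - Suc j) - c (m - j)) * g (Suc j))"
proof -
  have "(\<Sum>j\<le>m. c (m - j) * g (Suc j)) = c 0 * g (Suc m) + (\<Sum>j<m. c (m - j) * g (Suc j))"
    by (simp flip: lessThan_Suc_atMost)
  moreover have "(\<Sum>j\<le>m. c (m - j) * g j) = c m * g 0 + (\<Sum>j<m. c (m - Suc j) * g (Suc j))"
    by (simp add: sum.atMost_shift)
  ultimately show ?thesis
    by (simp add: right_diff_distrib left_diff_distrib sum_subtractf)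
qed

text \<open>After Abel summation the earlier values carry the nonnegative weights
  \<open>c (m - Suc j) - c (m - j)\<close>. Each product with \<open>g (Suc m)\<close> is split by
  2xy \<le> x^2 + y^2, and the weights telescope to \<open>c 0 - c m\<close>.\<close>

lemma decreasing_convolution_ge:
  fixes c g :: "nat \<Rightarrow> real"
  assumes c: "\<And>l. l < m \<Longrightarrow> c (Suc l) \<le> c l"
  shows "(c 0 + c m) / 2 * (g (Suc m))\<^sup>2 - c m * g 0 * g (Suc m)
      - (\<Sum>j<m. (c (m - Suc j) - c (m - j)) / 2 * (g (Suc j))\<^sup>2)
    \<le> g (Suc m) * (\<Sum>j\<le>m. c (m - j) * (g (Suc j) - g j))"
proof -
  let ?d = "\<lambda>j. c (m - Suc j) - c (m - j)" and ?y = "g (Suc m)"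
  have d: "0 \<le> ?d j" if "j < m" for j
    using c[of "m - Suc j"] that by (simp add: Suc_diff_Suc)
  have "(\<Sum>j<m. c (m - Suc j) - c (m - j)) = c 0 - c m"
    using sum_lessThan_telescope[of "\<lambda>j. c (m - j)" m] by simp
  then have tel: "(\<Sum>j<m. ?d j / 2 * ?y\<^sup>2) = (c 0 - c m) / 2 * ?y\<^sup>2"
    by (simp flip: sum_distrib_right sum_divide_distrib)
  have "0 \<le> (\<Sum>j<m. ?d j / 2 * (?y - g (Suc j))\<^sup>2)"
    by (rule sum_nonneg) (use d in auto)
  also have "\<dots> = (\<Sum>j<m. ?d j / 2 * ?y\<^sup>2 + ?d j / 2 * (g (Suc j))\<^sup>2 - ?y * (?d j * g (Suc j)))"
    by (rule sum.cong) (auto simp: power2_eq_square field_simps)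
  also have "\<dots> = (\<Sum>j<m. ?d j / 2 * ?y\<^sup>2) + (\<Sum>j<m. ?d j / 2 * (g (Suc j))\<^sup>2)
      - ?y * (\<Sum>j<m. ?d j * g (Suc j))"
    by (simp add: sum_subtractf sum.distrib sum_distrib_left)
  finally have "?y * (\<Sum>j<m. ?d j * g (Suc j))
      \<le> (c 0 - c m) / 2 * ?y\<^sup>2 + (\<Sum>j<m. ?d j / 2 * (g (Suc j))\<^sup>2)"
    unfolding tel by linarith
  then show ?thesis
    unfolding convolution_increment_by_parts by (simp add: field_simps power2_eq_square)
qed

text \<open>The square of \<open>g (Suc k)\<close> starts with weight (c 0 + c k)/2 and loses (c 0 -
  c (n - Suc k))/2 to later levels, again by telescoping. The remaining weight is invariant under
  reversing the levels, which prepares the pairing.\<close>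

lemma sum_decreasing_convolution_ge:
  fixes c g :: "nat \<Rightarrow> real"
  assumes "\<And>l. Suc l < n \<Longrightarrow> c (Suc l) \<le> c l"
  shows "(\<Sum>k<n. (c k + c (n - Suc k)) / 2 * (g (Suc k))\<^sup>2 - c k * g 0 * g (Suc k))
    \<le> (\<Sum>k<n. g (Suc k) * (\<Sum>j\<le>k. c (k - j) * (g (Suc j) - g j)))"
  using assms
proof (induction n)
  case (Suc n)
  let ?A = "\<lambda>n k. (c k + c (n - Suc k)) / 2 * (g (Suc k))\<^sup>2 - c k * g 0 * g (Suc k)"
  have "(\<Sum>k<n. ?A (Suc n) k)
      = (\<Sum>k<n. ?A n k - (c (n - Suc k) - c (n - k)) / 2 * (g (Suc k))\<^sup>2)"
    by (rule sum.cong) (auto simp: field_simps)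
  then have "(\<Sum>k<Suc n. ?A (Suc n) k)
      = (\<Sum>k<n. ?A n k) + ((c 0 + c n) / 2 * (g (Suc n))\<^sup>2 - c n * g 0 * g (Suc n)
        - (\<Sum>j<n. (c (n - Suc j) - c (n - j)) / 2 * (g (Suc j))\<^sup>2))"
    by (simp add: sum_subtractf add.commute)
  also have "\<dots> \<le> (\<Sum>k<n. g (Suc k) * (\<Sum>j\<le>k. c (k - j) * (g (Suc j) - g j)))
      + g (Suc n) * (\<Sum>j\<le>n. c (n - j) * (g (Suc j) - g j))"
    by (intro add_mono Suc.IH decreasing_convolution_ge) (use Suc.prems in auto)
  finally show ?case by simp
qed simp

section \<open>Absorbing the initial value by pairing levels\<close>

text \<open>Complete the squares in x and y; hypothesis \<open>le\<close> is the sign of the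
  remaining multiple of g^2.\<close>

lemma paired_form_nonneg:
  fixes a b \<mu> \<tau> g x y :: real
  assumes D: "0 < a + b - \<mu>" and le: "a\<^sup>2 + b\<^sup>2 \<le> 2 * (a + b - \<mu>) * \<tau>"
  shows "0 \<le> (a + b - \<mu>) / 2 * (x\<^sup>2 + y\<^sup>2) - a * g * x - b * g * y + \<tau> * g\<^sup>2"
    (is "0 \<le> ?E")
proof -
  have "2 * (a + b - \<mu>) * ?E = ((a + b - \<mu>) * x - a * g)\<^sup>2 + ((a + b - \<mu>) * y - b * g)\<^sup>2
      + (2 * (a + b - \<mu>) * \<tau> - (a\<^sup>2 + b\<^sup>2)) * g\<^sup>2"
    by algebra
  also have "0 \<le> \<dots>"
    using le by simp
  finally show ?thesis
    using D by (simp add: zero_le_mult_iff)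
qed

text \<open>Both a and b are within 1 - \<mu> of 1, and 1 - \<mu> lies in [0, 1], so (a - 1)^2 + (b
  - 1)^2 \<le> 2 (1 - \<mu>). The factor 1 is the \<tau> of
  \<open>paired_form_nonneg\<close>.\<close>

lemma paired_kernel_bound:
  fixes a b \<mu> :: real
  assumes "0 < \<mu>" "\<mu> \<le> b" "\<mu> \<le> a" "a \<le> 2 - \<mu>" "b \<le> 2 - \<mu>"
  shows "a\<^sup>2 + b\<^sup>2 \<le> 2 * (a + b - \<mu>) * 1"
proof -
  have "(a - 1)\<^sup>2 \<le> (1 - \<mu>)\<^sup>2" "(b - 1)\<^sup>2 \<le> (1 - \<mu>)\<^sup>2"
    using assms by (auto simp: abs_le_square_iff[symmetric])
  moreover have "(1 - \<mu>)\<^sup>2 \<le> 1 - \<mu>"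
    using assms by (auto simp: power2_eq_square mult_le_cancel_right2)
  ultimately show ?thesis
    by (simp add: power2_eq_square algebra_simps)
qed

text \<open>For the two end levels, \<tau> can be lowered by a quarter of the slack X = 2 - \<mu> -
  a. Written in \<mu> and the slacks X, Y, Z, twice the gap is a polynomial with nonnegative
  coefficients.\<close>

lemma end_pair_kernel_bound:
  fixes a b \<mu> :: real
  assumes "0 < \<mu>" "\<mu> \<le> b" "b \<le> a" "a \<le> 2 - \<mu>"
  shows "a\<^sup>2 + b\<^sup>2 \<le> 2 * (a + b - \<mu>) * (1 - (2 - \<mu> - a) / 4)"
proof -
  define X where "X = 2 - \<mu> - a"
  define Y where "Y = b - \<mu>"
  define Z where "Z = a - b"
  have nonneg: "0 \<le> X" "0 \<le> Y" "0 \<le> Z"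
    using assms by (auto simp: X_def Y_def Z_def)
  have \<mu>: "\<mu> = 1 - (X + Y + Z) / 2"
    by (simp add: X_def Y_def Z_def field_simps)
  have b: "b = \<mu> + Y" and a: "a = \<mu> + Y + Z"
    by (simp_all add: Y_def Z_def)
  have "2 * (2 * (a + b - \<mu>) * (1 - X / 4) - (a\<^sup>2 + b\<^sup>2))
      = (X + 2 * Y + 2 * Z) * \<mu> + 2 * X * Y + X * Z + 2 * Y * Z"
    unfolding a b \<mu> by (simp add: power2_eq_square field_simps)
  also have "0 \<le> \<dots>"
    using nonneg assms by simp
  finally show ?thesis
    by (simp add: X_def)
qed

lemma sum_paired_kernel_ge:
  fixes c x :: "nat \<Rightarrow> real"
  assumes n: "2 \<le> n" and \<mu>: "0 < \<mu>"
    and dec: "\<And>l. Suc l < n \<Longrightarrow> c (Suc l) \<le> c l"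
    and ge: "\<And>l. l < n \<Longrightarrow> \<mu> \<le> c l" and le: "c 0 \<le> 2 - \<mu>"
  shows "\<mu> / 2 * (\<Sum>k<n. (x (Suc k))\<^sup>2) - n / 2 * (x 0)\<^sup>2 + (2 - \<mu> - c 0) / 4 * (x 0)\<^sup>2
    \<le> (\<Sum>k<n. (c k + c (n - Suc k)) / 2 * (x (Suc k))\<^sup>2 - c k * x 0 * x (Suc k))"
proof -
  \<comment> \<open>\<open>P k\<close> is the summand of level \<open>k\<close> less its share of
    the target, so it remains to bound the sum of \<open>P\<close> below by the end-pair
    gain.\<close>
  define P where "P k = (c k + c (n - Suc k) - \<mu>) / 2 * (x (Suc k))\<^sup>2 - c k * x 0 * x (Suc k)
    + (x 0)\<^sup>2 / 2" for k
  \<comment> \<open>Summing \<open>R\<close> counts every pair twice, so a middle level paired with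
    itself needs no separate case.\<close>
  define R where "R k = P k + P (n - Suc k)" for k
  have c_le: "c l \<le> c 0" if "l < n" for l
    using that by (induction l) (use dec in force)+
  have R_ge: "(1 - \<tau>) * (x 0)\<^sup>2 \<le> R k"
    if k: "k < n" and \<tau>: "(c k)\<^sup>2 + (c (n - Suc k))\<^sup>2 \<le> 2 * (c k + c (n - Suc k) - \<mu>) * \<tau>" for k \<tau>
  proof -
    have "n - Suc (n - Suc k) = k" using k by simp
    then have "R k - (1 - \<tau>) * (x 0)\<^sup>2
      = (c k + c (n - Suc k) - \<mu>) / 2 * ((x (Suc k))\<^sup>2 + (x (Suc (n - Suc k)))\<^sup>2)
        - c k * x 0 * x (Suc k) - c (n - Suc k) * x 0 * x (Suc (n - Suc k)) + \<tau> * (x 0)\<^sup>2"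
      unfolding R_def P_def by (simp add: field_simps)
    moreover have "0 < c k + c (n - Suc k) - \<mu>"
      using ge[of k] ge[of "n - Suc k"] \<mu> k by simp
    ultimately show ?thesis
      using paired_form_nonneg[OF _ \<tau>] by (metis diff_ge_0_iff_ge)
  qed
  have R_nonneg: "0 \<le> R k" if k: "k < n" for k
  proof -
    have "(c k)\<^sup>2 + (c (n - Suc k))\<^sup>2 \<le> 2 * (c k + c (n - Suc k) - \<mu>) * 1"
      using ge[of k] ge[of "n - Suc k"] c_le[of k] c_le[of "n - Suc k"] k \<mu> le
      by (intro paired_kernel_bound) auto
    from R_ge[OF k this] show ?thesis by simp
  qed
  \<comment> \<open>The pair containing \<open>c 0\<close> contributes its gain at
    \<open>k = 0\<close> and again at \<open>k = n - 1\<close>, distinct indices since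
    \<open>2 \<le> n\<close>.\<close>
  have "(1 - (1 - (2 - \<mu> - c 0) / 4)) * (x 0)\<^sup>2 \<le> R 0"
    using n ge[of "n - 1"] c_le[of "n - 1"] \<mu> le
    by (intro R_ge end_pair_kernel_bound) auto
  moreover have "R (n - 1) = R 0"
    using n by (simp add: R_def)
  ultimately have "(2 - \<mu> - c 0) / 2 * (x 0)\<^sup>2 \<le> (\<Sum>k\<in>{0, n - 1}. R k)"
    using n by simp
  also have "\<dots> \<le> (\<Sum>k<n. R k)"
    by (rule sum_mono2) (use n R_nonneg in auto)
  also have "\<dots> = 2 * (\<Sum>k<n. P k)"
    by (simp add: R_def sum.distrib sum.nat_diff_reindex)
  finally have "(2 - \<mu> - c 0) / 4 * (x 0)\<^sup>2 \<le> (\<Sum>k<n. P k)"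
    by simp
  also have "\<dots> = (\<Sum>k<n. ((c k + c (n - Suc k)) / 2 * (x (Suc k))\<^sup>2 - c k * x 0 * x (Suc k))
      + ((x 0)\<^sup>2 / 2 - \<mu> / 2 * (x (Suc k))\<^sup>2))"
    unfolding P_def by (rule sum.cong) (auto simp: field_simps)
  also have "\<dots> = (\<Sum>k<n. (c k + c (n - Suc k)) / 2 * (x (Suc k))\<^sup>2 - c k * x 0 * x (Suc k))
      + (n / 2 * (x 0)\<^sup>2 - \<mu> / 2 * (\<Sum>k<n. (x (Suc k))\<^sup>2))"
    by (simp add: sum.distrib sum_subtractf sum_distrib_left)
  finally show ?thesis by linarith
qed

section \<open>Lower bound for sums of exponential kernels\<close>

lemma sum_half_step_power2:
  "(\<Sum>k<n. (g (Suc k))\<^sup>2) = (\<Sum>k<n. (half_step g (Suc k))\<^sup>2)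
    + (\<Sum>k<n. (g (Suc k) - g k)\<^sup>2) / 4 + ((g n)\<^sup>2 - (g 0)\<^sup>2) / 2"
proof (induction n)
  case (Suc n)
  then show ?case
    by (simp add: half_step_def power2_eq_square field_simps)
qed simp

lemma sum_mult_increment:
  fixes g :: "nat \<Rightarrow> real"
  shows "(\<Sum>k<n. g (Suc k) * (g (Suc k) - g k))
    = ((g n)\<^sup>2 - (g 0)\<^sup>2) / 2 + (\<Sum>k<n. (g (Suc k) - g k)\<^sup>2) / 2"
proof (induction n)
  case (Suc n)
  then show ?case
    by (simp add: power2_eq_square field_simps)
qed simp

text \<open>With \<open>B = 1 / (1 - \<beta>)\<close> the tested expression is the FIDR operator up
  to a positive factor. The hypotheses on \<kappa> are what the approximation bounds at the first
  and last time points provide.\<close>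

lemma exp_sum_form_ge:
  fixes p V :: "'i \<Rightarrow> real" and g \<kappa> :: "nat \<Rightarrow> real"
  assumes n: "2 \<le> n" and \<mu>: "0 < \<mu>" and B: "1 \<le> B"
    and p: "\<And>i. i \<in> I \<Longrightarrow> 0 \<le> p i" "\<And>i. i \<in> I \<Longrightarrow> p i \<le> 1"
    and V: "\<And>i. i \<in> I \<Longrightarrow> 0 \<le> V i"
    and \<kappa>: "\<And>l. \<kappa> l = (\<Sum>i\<in>I. V i * p i ^ l)"
    and le: "\<kappa> 0 \<le> 2 - \<mu>" and ge: "\<mu> \<le> \<kappa> (n - 2)"
    and last: "\<mu> - \<kappa> (n - 1) \<le> 2 - \<mu> - \<kappa> 0"
  shows "\<mu> / 2 * (\<Sum>k<n. (g (Suc k))\<^sup>2) - (B + (real n - 1)) / 2 * (g 0)\<^sup>2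
    \<le> (\<Sum>k<n. g (Suc k) * ((B - \<kappa> 0 / 2) * (g (Suc k) - g k)
        + (\<Sum>i\<in>I. V i * ((exp_memory (p i) g (Suc k) + exp_memory (p i) g k) / 2))))"
proof -
  define d where "d k = g (Suc k) - g k" for k
  define h where "h = half_step g"
  define K where "K k = (\<Sum>i\<in>I. V i * exp_memory (p i) h (Suc k))" for k
  \<comment> \<open>The last value \<open>\<kappa> (n - 1)\<close> may drop below \<open>\<mu>\<close>. It occurs only in the product of the last
    half-step value with the first increment, so raising it to \<open>\<mu>\<close> costs a single term.\<close>
  define c where "c l = (if l = n - 1 then max (\<kappa> l) \<mu> else \<kappa> l)" for l
  define y where "y = c (n - 1) - \<kappa> (n - 1)"
  \<comment> \<open>This slack satisfies B - \<kappa> 0 / 2 = (B - 1) + (X + \<mu>)/2. The X part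
    and half of the d2 share of the \<mu> part pay for the raised kernel value; the rest of the
    \<mu> part turns half-step squares into full-level squares.\<close>
  define X where "X = 2 - \<mu> - \<kappa> 0"
  define d2 where "d2 = (\<Sum>k<n. (d k)\<^sup>2)"
  define h2 where "h2 = (\<Sum>k<n. (h (Suc k))\<^sup>2)"
  have \<kappa>_nonneg: "0 \<le> \<kappa> l" for l
    unfolding \<kappa> by (intro sum_nonneg mult_nonneg_nonneg zero_le_power p V)
  have \<kappa>_dec: "\<kappa> (Suc l) \<le> \<kappa> l" for l
    unfolding \<kappa> by (intro sum_mono mult_left_mono power_decreasing p V) auto
  then have \<kappa>_antimono: "\<kappa> l' \<le> \<kappa> l" if "l \<le> l'" for l l'
    using that by (rule lift_Suc_antimono_le)
  have c_ge: "\<mu> \<le> c l" if "l < n" for l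
  proof (cases "l = n - 1")
    case False
    then have "\<kappa> (n - 2) \<le> \<kappa> l"
      using that by (intro \<kappa>_antimono) simp
    with ge False show ?thesis by (simp add: c_def)
  qed (simp add: c_def)
  have c_dec: "c (Suc l) \<le> c l" if "Suc l < n" for l
  proof (cases "Suc l = n - 1")
    case True
    then have "l = n - 2" by simp
    with True ge \<kappa>_dec[of l] show ?thesis by (simp add: c_def)
  next
    case False
    moreover have "l \<noteq> n - 1" using that by simp
    ultimately show ?thesis using \<kappa>_dec[of l] by (simp add: c_def)
  qed
  have c0: "c 0 = \<kappa> 0"
    using n by (simp add: c_def)
  \<comment> \<open>When the value is actually raised, \<open>y \<le> X\<close> is hypothesis
    \<open>last\<close>, and \<open>y \<le> \<mu>\<close> holds because \<kappa> is
    nonnegative.\<close>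
  have y: "0 \<le> y" "y \<le> X" "y \<le> \<mu>"
    using last le \<kappa>_nonneg[of "n - 1"] \<mu> by (auto simp: y_def X_def c_def max_def)

  have K_sum: "K k = (\<Sum>j\<le>k. \<kappa> (k - j) * (h (Suc j) - h j))" for k
    unfolding K_def exp_memory_eq_sum \<kappa> sum_distrib_left sum_distrib_right
    by (subst sum.swap) (simp add: mult.assoc)
  have c_sum: "(\<Sum>j\<le>k. c (k - j) * (h (Suc j) - h j))
      = K k + (if k = n - 1 then y * (d 0 / 2) else 0)" if "k < n" for k
  proof -
    have "(\<Sum>j\<le>k. c (k - j) * (h (Suc j) - h j))
        = (\<Sum>j\<le>k. \<kappa> (k - j) * (h (Suc j) - h j)
            + (if j = 0 then if k = n - 1 then y * (h 1 - h 0) else 0 else 0))"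
      using that by (intro sum.cong) (auto simp: y_def c_def algebra_simps)
    also have "h 1 - h 0 = d 0 / 2"
      by (simp add: h_def half_step_def d_def field_simps)
    finally show ?thesis
      by (simp add: K_sum sum.distrib)
  qed
  have "(\<Sum>k<n. h (Suc k) * (\<Sum>j\<le>k. c (k - j) * (h (Suc j) - h j)))
      = (\<Sum>k<n. h (Suc k) * K k + (if k = n - 1 then h n * (y * (d 0 / 2)) else 0))"
    by (rule sum.cong) (use c_sum n in \<open>auto simp: algebra_simps\<close>)
  also have "\<dots> = (\<Sum>k<n. h (Suc k) * K k) + h n * (y * (d 0 / 2))"
    using n by (simp add: sum.distrib)
  finally have hK: "\<mu> / 2 * h2 - n / 2 * (g 0)\<^sup>2 + X / 4 * (g 0)\<^sup>2
      \<le> (\<Sum>k<n. h (Suc k) * K k) + h n * (y * (d 0 / 2))"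
    using sum_paired_kernel_ge[of n \<mu> c h, OF n \<mu> c_dec c_ge]
      sum_decreasing_convolution_ge[of n c h, OF c_dec] le
    by (simp add: c0 X_def h2_def) (simp add: h_def half_step_def)

  have "d k * K k = (\<Sum>i\<in>I. V i / 2 * (d k * (exp_memory (p i) g (Suc k) + exp_memory (p i) g k)))" for k
    unfolding K_def h_def exp_memory_half_step sum_distrib_left
    by (rule sum.cong) simp_all
  then have "(\<Sum>k<n. d k * K k)
      = (\<Sum>k<n. \<Sum>i\<in>I. V i / 2 * (d k * (exp_memory (p i) g (Suc k) + exp_memory (p i) g k)))"
    by (simp only:)
  also have "\<dots> = (\<Sum>i\<in>I. V i / 2 * (\<Sum>k<n. d k * (exp_memory (p i) g (Suc k) + exp_memory (p i) g k)))"
    unfolding sum_distrib_left by (rule sum.swap)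
  also have "0 \<le> \<dots>"
    unfolding d_def by (intro sum_nonneg mult_nonneg_nonneg sum_increment_exp_memory_nonneg) (use p V in auto)
  finally have dK: "0 \<le> (\<Sum>k<n. d k * K k)" .

  have "g (Suc k) * (\<Sum>i\<in>I. V i * ((exp_memory (p i) g (Suc k) + exp_memory (p i) g k) / 2))
      = h (Suc k) * K k + d k * K k / 2" for k
  proof -
    have "g (Suc k) = h (Suc k) + d k / 2"
      by (simp add: h_def half_step_def d_def field_simps)
    then show ?thesis
      unfolding K_def h_def exp_memory_half_step by (simp add: algebra_simps)
  qed
  then have "(\<Sum>k<n. g (Suc k) * ((B - \<kappa> 0 / 2) * (g (Suc k) - g k)
        + (\<Sum>i\<in>I. V i * ((exp_memory (p i) g (Suc k) + exp_memory (p i) g k) / 2))))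
      = (\<Sum>k<n. (B - \<kappa> 0 / 2) * (g (Suc k) * (g (Suc k) - g k)) + (h (Suc k) * K k + d k * K k / 2))"
    by (simp add: distrib_left mult.left_commute)
  also have "\<dots> = (B - \<kappa> 0 / 2) * (\<Sum>k<n. g (Suc k) * (g (Suc k) - g k))
      + ((\<Sum>k<n. h (Suc k) * K k) + (\<Sum>k<n. d k * K k) / 2)"
    by (simp add: sum.distrib sum_distrib_left sum_divide_distrib)
  also have "(\<Sum>k<n. g (Suc k) * (g (Suc k) - g k)) = ((g n)\<^sup>2 - (g 0)\<^sup>2) / 2 + d2 / 2"
    unfolding sum_mult_increment d2_def d_def ..
  finally have Q: "(\<Sum>k<n. g (Suc k) * ((B - \<kappa> 0 / 2) * (g (Suc k) - g k)
        + (\<Sum>i\<in>I. V i * ((exp_memory (p i) g (Suc k) + exp_memory (p i) g k) / 2))))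
      = (B - \<kappa> 0 / 2) * (((g n)\<^sup>2 - (g 0)\<^sup>2) / 2 + d2 / 2)
      + ((\<Sum>k<n. h (Suc k) * K k) + (\<Sum>k<n. d k * K k) / 2)" (is "?Q = _") .

  have "(d 0)\<^sup>2 + (d (n - 1))\<^sup>2 = (\<Sum>k\<in>{0, n - 1}. (d k)\<^sup>2)"
    using n by simp
  also have "\<dots> \<le> d2"
    unfolding d2_def by (rule sum_mono2) (use n in auto)
  finally have d2: "(d 0)\<^sup>2 + (d (n - 1))\<^sup>2 \<le> d2" .
  have hn: "h n = g n - d (n - 1) / 2"
    using n by (simp add: h_def half_step_def d_def field_simps)
  \<comment> \<open>The squares are chosen so that, by \<open>hn\<close>, their cross terms add up
    to minus the error \<open>h n * (y * (d 0 / 2))\<close>.\<close>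
  have "0 \<le> y / 4 * (g n - d 0)\<^sup>2 + y / 8 * (d (n - 1) + d 0)\<^sup>2"
    using y by simp
  also have "\<dots> = y / 4 * (g n)\<^sup>2 + (y / 4 + y / 8) * (d 0)\<^sup>2 + y / 8 * (d (n - 1))\<^sup>2 - h n * (y * (d 0 / 2))"
    unfolding hn by (simp add: power2_eq_square field_simps)
  also have "\<dots> \<le> X / 4 * (g n)\<^sup>2 + (X / 4 + \<mu> / 8) * (d 0)\<^sup>2 + (X / 4 + \<mu> / 8) * (d (n - 1))\<^sup>2 - h n * (y * (d 0 / 2))"
    using y by (intro diff_right_mono add_mono mult_right_mono) auto
  also have "\<dots> = X / 4 * (g n)\<^sup>2 + (X / 4 + \<mu> / 8) * ((d 0)\<^sup>2 + (d (n - 1))\<^sup>2) - h n * (y * (d 0 / 2))"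
    by (simp add: algebra_simps)
  also have "\<dots> \<le> X / 4 * (g n)\<^sup>2 + (X / 4 + \<mu> / 8) * d2 - h n * (y * (d 0 / 2))"
    using y \<mu> d2 by (intro diff_right_mono add_mono mult_left_mono) auto
  finally have err: "h n * (y * (d 0 / 2)) \<le> X / 4 * (g n)\<^sup>2 + (X / 4 + \<mu> / 8) * d2"
    by linarith
  have "0 \<le> (B - 1) * ((g n)\<^sup>2 / 2 + d2 / 2)"
    using B by (simp add: d2_def sum_nonneg)
  \<comment> \<open>The resulting -X/4 (g 0)^2 is cancelled by the end-pair gain in
    \<open>hK\<close>.\<close>
  moreover have "(B - \<kappa> 0 / 2) * (((g n)\<^sup>2 - (g 0)\<^sup>2) / 2 + d2 / 2)
      = (B - 1) * ((g n)\<^sup>2 / 2 + d2 / 2) - (B - 1) / 2 * (g 0)\<^sup>2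
        + (X + \<mu>) / 4 * ((g n)\<^sup>2 - (g 0)\<^sup>2 + d2)"
    by (simp add: X_def field_simps)
  ultimately have "X / 4 * (g n)\<^sup>2 + (X / 4 + \<mu> / 8) * d2 - (B - 1) / 2 * (g 0)\<^sup>2 - X / 4 * (g 0)\<^sup>2
      + \<mu> / 2 * (d2 / 4 + ((g n)\<^sup>2 - (g 0)\<^sup>2) / 2)
      \<le> (B - \<kappa> 0 / 2) * (((g n)\<^sup>2 - (g 0)\<^sup>2) / 2 + d2 / 2)"
    by (simp add: field_simps)
  moreover have "\<mu> / 2 * (\<Sum>k<n. (g (Suc k))\<^sup>2) = \<mu> / 2 * h2 + \<mu> / 2 * (d2 / 4 + ((g n)\<^sup>2 - (g 0)\<^sup>2) / 2)"
    using sum_half_step_power2[of g n] by (simp add: h2_def h_def d2_def d_def algebra_simps)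
  moreover have "(B + (real n - 1)) / 2 * (g 0)\<^sup>2 = n / 2 * (g 0)\<^sup>2 + (B - 1) / 2 * (g 0)\<^sup>2"
    by (simp add: field_simps)
  ultimately show ?thesis
    unfolding Q using hK dK err by linarith
qed

section \<open>Coercivity of the FIDR operator\<close>

text \<open>This is tanh(x/2) \<le> x/2; it gives \<open>r i \<le> 1\<close> in
  \<open>fidr_coercive\<close>.\<close>

lemma two_one_minus_exp_le:
  fixes x :: real
  assumes "0 \<le> x"
  shows "2 * (1 - exp (- x)) \<le> x * (1 + exp (- x))"
proof -
  let ?f = "\<lambda>x::real. x * (1 + exp (- x)) - 2 * (1 - exp (- x))"
  have "?f 0 \<le> ?f x"
  proof (rule DERIV_nonneg_imp_nondecreasing[OF assms])
    fix t :: real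
    have "(?f has_real_derivative 1 - exp (- t) * (1 + t)) (at t)"
      by (auto intro!: derivative_eq_intros simp: algebra_simps)
    moreover have "exp (- t) * (1 + t) \<le> exp (- t) * exp t"
      by (intro mult_left_mono exp_ge_add_one_self) auto
    then have "0 \<le> 1 - exp (- t) * (1 + t)"
      by (simp flip: exp_add)
    ultimately show "\<exists>y. (?f has_real_derivative y) (at t) \<and> 0 \<le> y" by blast
  qed
  then show ?thesis by simp
qed

text \<open>From G' = p G + d follows (1 + p) G = (G' + G) - d. So the lagged memory G is an average
  of two levels minus a share of the increment; the factor 2/(1 + p) goes into \<open>V\<close>, and
  the shares lower the increment coefficient by half the sum of \<open>V\<close>.\<close>

lemma fidr_Suc_eq:
  fixes \<beta> dt :: real and w s g
  defines "M \<equiv> dt powr (- \<beta>)"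
  defines "p \<equiv> \<lambda>i. exp (- s i * dt)"
  defines "V \<equiv> \<lambda>i. w i * p i * (2 * (1 - p i) / (s i * dt * (1 + p i))) / M"
  assumes \<beta>: "\<beta> < 1" and dt: "0 < dt" and s: "\<And>i. 1 \<le> i \<Longrightarrow> i \<le> NA \<Longrightarrow> 0 < s i"
  shows "fidr \<beta> dt NA w s g (Suc k)
    = M / Gamma (1 - \<beta>) * ((1 / (1 - \<beta>) - (\<Sum>i = 1..NA. V i) / 2) * (g (Suc k) - g k)
        + (\<Sum>i = 1..NA. V i * ((exp_memory (p i) g (Suc k) + exp_memory (p i) g k) / 2)))"
proof -
  have M: "0 < M" using dt by (simp add: M_def)
  have \<Gamma>: "Gamma (2 - \<beta>) = (1 - \<beta>) * Gamma (1 - \<beta>)"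
  proof -
    have "1 - \<beta> \<notin> \<int>\<^sub>\<le>\<^sub>0" using \<beta> by (auto elim!: nonpos_Ints_cases)
    from Gamma_plus1[OF this] show ?thesis by (simp add: algebra_simps)
  qed
  have "w i * fidr_Psi (s i) dt g (Suc k)
      = M * (V i * ((exp_memory (p i) g (Suc k) + exp_memory (p i) g k) / 2)
          - V i / 2 * (g (Suc k) - g k))" if "i \<in> {1..NA}" for i
  proof -
    have "0 < s i * dt" using that s dt by simp
    moreover have "0 < 1 + p i" by (simp add: p_def add_pos_pos)
    moreover have "w i * fidr_Psi (s i) dt g (Suc k)
      = w i * ((1 - p i) * p i / (s i * dt)) * exp_memory (p i) g k"
      unfolding fidr_Psi_Suc_eq p_def by simp
    moreover have "M * (V i * ((exp_memory (p i) g (Suc k) + exp_memory (p i) g k) / 2)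
          - V i / 2 * (g (Suc k) - g k)) = M * V i * (1 + p i) / 2 * exp_memory (p i) g k"
      by (simp add: field_simps)
    moreover have "M * V i = w i * p i * (2 * (1 - p i) / (s i * dt * (1 + p i)))"
      using M by (simp add: V_def)
    ultimately show ?thesis by (simp del: right_diff_distrib_numeral)
  qed
  then have memory: "(\<Sum>i = 1..NA. w i * fidr_Psi (s i) dt g (Suc k))
      = M * ((\<Sum>i = 1..NA. V i * ((exp_memory (p i) g (Suc k) + exp_memory (p i) g k) / 2))
          - (\<Sum>i = 1..NA. V i) / 2 * (g (Suc k) - g k))"
    by (simp add: sum_distrib_left sum_distrib_right sum_subtractf sum_divide_distrib right_diff_distrib)
  have "M = 1 / dt powr \<beta>"
    by (simp add: M_def powr_minus_divide)
  then have increment: "(g (Suc k) - g k) / (dt powr \<beta> * Gamma (2 - \<beta>)) = M / Gamma (1 - \<beta>) * (1 / (1 - \<beta>) * (g (Suc k) - g k))"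
    unfolding \<Gamma> by simp
  have "M / G * (c * d) + 1 / G * (M * (S - W / 2 * d)) = M / G * ((c - W / 2) * d + S)" for c d G S W :: real
    by (simp add: algebra_simps)
  then show ?thesis
    unfolding fidr_def diff_Suc_1 memory increment .
qed

lemma fidr_coercive:
  fixes \<beta> dt \<epsilon> :: real and w s :: "nat \<Rightarrow> real" and g :: "nat \<Rightarrow> real"
  assumes \<beta>: "0 < \<beta>" "\<beta> < 1" and dt: "0 < dt" and n: "1 \<le> n"
    and s: "\<And>i. 1 \<le> i \<Longrightarrow> i \<le> NA \<Longrightarrow> 0 < s i"
    and w: "\<And>i. 1 \<le> i \<Longrightarrow> i \<le> NA \<Longrightarrow> 0 < w i"
    and first: "(\<Sum>i = 1..NA. w i * exp (- s i * dt)) \<le> dt powr (- \<beta>) + \<epsilon>"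
    and last: "(n * dt) powr (- \<beta>) - \<epsilon> \<le> (\<Sum>i = 1..NA. w i * exp (- s i * (n * dt)))"
    and pos: "0 < ((n * dt) powr (- \<beta>) - \<epsilon>) / Gamma (1 - \<beta>)"
  shows "((n * dt) powr (- \<beta>) - \<epsilon>) / Gamma (1 - \<beta>) / 2 * (dt * (\<Sum>k = 1..n. (g k)\<^sup>2))
      - (dt powr (1 - \<beta>) / (1 - \<beta>) + ((real n - 1) * dt) * dt powr (- \<beta>)) / (2 * Gamma (1 - \<beta>)) * (g 0)\<^sup>2
    \<le> dt * (\<Sum>k = 1..n. fidr \<beta> dt NA w s g k * g k)"
proof -
  define M where "M = dt powr (- \<beta>)"
  define \<mu> where "\<mu> = ((n * dt) powr (- \<beta>) - \<epsilon>) / M"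
  define p where "p i = exp (- s i * dt)" for i
  define r where "r i = 2 * (1 - p i) / (s i * dt * (1 + p i))" for i
  define V where "V i = w i * p i * r i / M" for i
  define \<kappa> where "\<kappa> l = (\<Sum>i = 1..NA. V i * p i ^ l)" for l
  define B where "B = 1 / (1 - \<beta>)"
  define D where "D k = (B - \<kappa> 0 / 2) * (g (Suc k) - g k)
    + (\<Sum>i = 1..NA. V i * ((exp_memory (p i) g (Suc k) + exp_memory (p i) g k) / 2))" for k
  have M: "0 < M" using dt by (simp add: M_def)
  have \<Gamma>: "0 < Gamma (1 - \<beta>)" using \<beta> by (intro Gamma_real_pos) simp
  have \<mu>: "0 < \<mu>" using pos \<Gamma> M by (simp add: \<mu>_def zero_less_divide_iff)
  have B: "1 \<le> B" using \<beta> by (simp add: B_def)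
  \<comment> \<open>Here the bound 2 - \<mu> arises: M \<mu> \<le> M - \<epsilon> is equivalent to M
    + \<epsilon> \<le> M (2 - \<mu>).\<close>
  have "(n * dt) powr (- \<beta>) \<le> M"
    unfolding M_def using n dt \<beta> by (intro powr_mono2') auto
  moreover have M\<mu>: "(n * dt) powr (- \<beta>) - \<epsilon> = M * \<mu>"
    using M by (simp add: \<mu>_def)
  ultimately have \<mu>_M: "M + \<epsilon> \<le> M * (2 - \<mu>)"
    by (simp add: right_diff_distrib)
  \<comment> \<open>The enclosure p \<le> r \<le> 1 transfers the bounds on the exponential sums to
    the kernel \<kappa>.\<close>
  have p: "0 < p i" "p i < 1" "p i \<le> r i" "r i \<le> 1" if "i \<in> {1..NA}" for i
  proof -
    have \<theta>: "0 < s i * dt" using s that dt by simp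
    then show p: "0 < p i" "p i < 1" by (auto simp: p_def)
    show "r i \<le> 1"
      using two_one_minus_exp_le[of "s i * dt"] \<theta>
      by (simp add: r_def p_def divide_le_eq_1_pos add_pos_pos)
    have "p i * (1 + s i * dt) \<le> p i * exp (s i * dt)"
      by (intro mult_left_mono exp_ge_add_one_self) (use p in auto)
    also have "\<dots> = 1" by (simp add: p_def flip: exp_add)
    finally have *: "s i * dt * p i \<le> 1 - p i" by (simp add: algebra_simps)
    have "p i * (s i * dt * (1 + p i)) = (s i * dt * p i) * (1 + p i)" by simp
    also have "\<dots> \<le> (1 - p i) * 2"
      using * p by (intro mult_mono) auto
    finally show "p i \<le> r i"
      using \<theta> p unfolding r_def by (subst pos_le_divide_eq) auto
  qed
  have V: "0 \<le> V i" if "i \<in> {1..NA}" for i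
    using p[OF that] w[of i] that M by (simp add: V_def)
  have fidr_D: "fidr \<beta> dt NA w s g (Suc k) = M / Gamma (1 - \<beta>) * D k" for k
    using fidr_Suc_eq[where \<beta> = \<beta> and dt = dt and NA = NA and w = w and s = s and g = g and k = k, OF \<beta>(2) dt s]
    by (simp add: D_def \<kappa>_def B_def V_def r_def p_def M_def)
  have "\<mu> / 2 * (\<Sum>k<n. (g (Suc k))\<^sup>2) - (B + (real n - 1)) / 2 * (g 0)\<^sup>2 \<le> (\<Sum>k<n. g (Suc k) * D k)"
  proof (cases "n = 1")
    case True
    \<comment> \<open>With a single increment the averaged memory cancels the correction \<kappa> 0
      / 2 exactly.\<close>
    have "(\<Sum>i = 1..NA. V i * ((exp_memory (p i) g 1 + exp_memory (p i) g 0) / 2)) = \<kappa> 0 / 2 * (g 1 - g 0)"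
      by (simp add: \<kappa>_def sum_distrib_right sum_divide_distrib)
    then have D0: "D 0 = B * (g 1 - g 0)"
      by (simp add: D_def left_diff_distrib)
    \<comment> \<open>For n = 1 both sampled bounds are at \<open>dt\<close>; together they force 0
      \<le> \<epsilon>.\<close>
    have "M * \<mu> \<le> M * 1"
      using first last True M by (simp add: \<mu>_def M_def)
    then have "\<mu> \<le> B"
      using M B by simp
    then have "0 \<le> B / 2 * (g 1 - g 0)\<^sup>2 + (B - \<mu>) / 2 * (g 1)\<^sup>2"
      using B by simp
    also have "\<dots> = g 1 * (B * (g 1 - g 0)) + B / 2 * (g 0)\<^sup>2 - \<mu> / 2 * (g 1)\<^sup>2"
      by (simp add: power2_eq_square field_simps)
    finally have "\<mu> / 2 * (g 1)\<^sup>2 - B / 2 * (g 0)\<^sup>2 \<le> g 1 * (B * (g 1 - g 0))"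
      by linarith
    then show ?thesis
      using True D0 by simp
  next
    case False
    with n have n2: "2 \<le> n" by simp
    define S where "S k = (\<Sum>i = 1..NA. w i * p i ^ k)" for k
    have S1: "S 1 \<le> M * (2 - \<mu>)"
      using first \<mu>_M by (simp add: S_def p_def M_def)
    have "exp (- s i * (n * dt)) = p i ^ n" for i
      by (simp add: p_def mult_ac flip: exp_of_nat_mult)
    then have Sn: "M * \<mu> \<le> S n"
      using last M\<mu> by (simp add: S_def)
    have M\<kappa>: "M * \<kappa> l = (\<Sum>i = 1..NA. w i * r i * p i ^ Suc l)" for l
      using M by (simp add: \<kappa>_def V_def sum_distrib_left mult_ac)
    have "M * \<kappa> 0 \<le> S 1"
      unfolding M\<kappa> S_def
    proof (rule sum_mono)
      fix i assume i: "i \<in> {1..NA}"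
      have "w i * r i * p i ^ Suc 0 \<le> w i * 1 * p i ^ Suc 0"
        using p[OF i] w[of i] i by (intro mult_right_mono mult_left_mono) auto
      then show "w i * r i * p i ^ Suc 0 \<le> w i * p i ^ 1" by simp
    qed
    with S1 have "M * \<kappa> 0 \<le> M * (2 - \<mu>)" by simp
    then have \<kappa>0: "\<kappa> 0 \<le> 2 - \<mu>" using M by simp
    \<comment> \<open>Trading one factor \<open>p i\<close> for \<open>r i\<close> costs one index,
      so the lower bound is secured at \<open>n - 2\<close> but not at \<open>n - 1\<close>.\<close>
    have "S n \<le> M * \<kappa> (n - 2)"
      unfolding M\<kappa> S_def
    proof (rule sum_mono)
      fix i assume i: "i \<in> {1..NA}"
      have "n = Suc (Suc (n - 2))" using n2 by simp
      then have "w i * p i ^ n = w i * p i * p i ^ Suc (n - 2)"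
        by (metis power_Suc mult.assoc)
      also have "\<dots> \<le> w i * r i * p i ^ Suc (n - 2)"
        using p[OF i] w[of i] i by (intro mult_right_mono mult_left_mono) auto
      finally show "w i * p i ^ n \<le> w i * r i * p i ^ Suc (n - 2)" .
    qed
    with Sn have "M * \<mu> \<le> M * \<kappa> (n - 2)" by simp
    then have \<kappa>n: "\<mu> \<le> \<kappa> (n - 2)" using M by simp
    \<comment> \<open>The deficit at the last index is at most the slack at the first, since 1 - r
      \<ge> 0 and p^n \<le> p.\<close>
    have "S n - M * \<kappa> (n - 1) = (\<Sum>i = 1..NA. w i * (1 - r i) * p i ^ n)"
      using n2 by (simp add: M\<kappa> S_def sum_subtractf algebra_simps)
    also have "\<dots> \<le> (\<Sum>i = 1..NA. w i * (1 - r i) * p i ^ 1)"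
      using p w n by (intro sum_mono mult_left_mono power_decreasing) (auto simp: less_imp_le)
    also have "\<dots> = S 1 - M * \<kappa> 0"
      by (simp add: M\<kappa> S_def sum_subtractf algebra_simps)
    finally have "M * (\<mu> - \<kappa> (n - 1)) \<le> M * (2 - \<mu> - \<kappa> 0)"
      using S1 Sn by (simp add: algebra_simps)
    then have \<kappa>l: "\<mu> - \<kappa> (n - 1) \<le> 2 - \<mu> - \<kappa> 0" using M by simp
    show ?thesis
      unfolding D_def
    proof (rule exp_sum_form_ge)
      show "\<kappa> l = (\<Sum>i = 1..NA. V i * p i ^ l)" for l by (rule \<kappa>_def)
    qed (use n2 \<mu> B V \<kappa>0 \<kappa>n \<kappa>l p in \<open>auto intro: less_imp_le\<close>)
  qed
  then have "dt * M / Gamma (1 - \<beta>) * (\<mu> / 2 * (\<Sum>k<n. (g (Suc k))\<^sup>2) - (B + (real n - 1)) / 2 * (g 0)\<^sup>2)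
      \<le> dt * M / Gamma (1 - \<beta>) * (\<Sum>k<n. g (Suc k) * D k)"
    using dt M \<Gamma> by (intro mult_left_mono) auto
  also have "\<dots> = dt * (\<Sum>k = 1..n. fidr \<beta> dt NA w s g k * g k)"
    by (simp add: sum.atLeast1_atMost_eq fidr_D sum_distrib_left mult_ac)
  also have "dt * M / Gamma (1 - \<beta>) * (\<mu> / 2 * (\<Sum>k<n. (g (Suc k))\<^sup>2) - (B + (real n - 1)) / 2 * (g 0)\<^sup>2)
    = ((n * dt) powr (- \<beta>) - \<epsilon>) / Gamma (1 - \<beta>) / 2 * (dt * (\<Sum>k = 1..n. (g k)\<^sup>2))
      - (dt * M * B + ((real n - 1) * dt) * M) / (2 * Gamma (1 - \<beta>)) * (g 0)\<^sup>2"
    using \<Gamma> unfolding M\<mu> by (simp add: sum.atLeast1_atMost_eq field_simps)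
  also have "dt * M = dt powr (1 - \<beta>)"
    using dt by (simp add: M_def powr_mult_base)
  finally show ?thesis
    by (simp add: B_def M_def)
qed

section \<open>Discrete Sobolev inequality and summation by parts\<close>

lemma grid_norm2_eq_sum_midpoint:
  assumes "0 < N"
  shows "grid_norm2 h N v = h * (\<Sum>i<N. ((v i)\<^sup>2 + (v (Suc i))\<^sup>2) / 2)"
proof -
  obtain m where m: "N = Suc m" using assms gr0_implies_Suc by blast
  have "(\<Sum>i<Suc m. ((v i)\<^sup>2 + (v (Suc i))\<^sup>2) / 2)
      = (1/2) * (v 0)\<^sup>2 + (\<Sum>i = 1..m. (v i)\<^sup>2) + (1/2) * (v (Suc m))\<^sup>2"
    by (induction m) (auto simp: field_simps)
  then show ?thesis by (simp add: grid_norm2_def m)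
qed

lemma sum_interior_power2_le_grid_norm2:
  assumes "0 \<le> h"
  shows "h * (\<Sum>i = 1..N - 1. (v i)\<^sup>2) \<le> grid_norm2 h N v"
  unfolding grid_norm2_def using assms by (intro mult_left_mono) auto

text \<open>Telescope v^2 between the two nodes, factor each difference of squares and apply Young's
  inequality with parameter \<theta>; then extend the sum to all cells.\<close>

lemma grid_power2_diff_le:
  fixes v :: "nat \<Rightarrow> real"
  assumes h: "0 < h" and \<theta>: "0 < \<theta>" and "i \<le> N" "j \<le> N" and N: "0 < N"
  shows "(v i)\<^sup>2 \<le> (v j)\<^sup>2 + \<theta> * (h * (\<Sum>i<N. ((v (Suc i) - v i) / h)\<^sup>2)) + grid_norm2 h N v / \<theta>"
proof -
  let ?b = "\<lambda>k. \<theta> * h * ((v (Suc k) - v k) / h)\<^sup>2 + h / \<theta> * (((v k)\<^sup>2 + (v (Suc k))\<^sup>2) / 2)"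
  have b: "\<bar>(v (Suc k))\<^sup>2 - (v k)\<^sup>2\<bar> \<le> ?b k" for k
  proof -
    let ?d = "v (Suc k) - v k" and ?s = "v (Suc k) + v k"
    have "0 \<le> (\<bar>?d\<bar> - h / (2 * \<theta>) * \<bar>?s\<bar>)\<^sup>2 * (\<theta> / h)"
      using h \<theta> by simp
    also have "\<dots> = \<theta> / h * ?d\<^sup>2 + h / (4 * \<theta>) * ?s\<^sup>2 - \<bar>?d\<bar> * \<bar>?s\<bar>"
      using h \<theta> by (simp add: power2_diff power_mult_distrib field_simps power2_eq_square)
    finally have "\<bar>?d * ?s\<bar> \<le> \<theta> / h * ?d\<^sup>2 + h / (4 * \<theta>) * ?s\<^sup>2"
      by (simp add: abs_mult)
    \<comment> \<open>Adding ?d^2 turns ?s^2 into twice the sum of the two nodal squares, the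
      trapezoidal weight of the cell.\<close>
    also have "\<dots> \<le> \<theta> / h * ?d\<^sup>2 + h / (4 * \<theta>) * (?s\<^sup>2 + ?d\<^sup>2)"
      using h \<theta> by (intro add_left_mono mult_left_mono) auto
    also have "?d * ?s = (v (Suc k))\<^sup>2 - (v k)\<^sup>2"
      by (simp add: power2_eq_square algebra_simps)
    also have "h / (4 * \<theta>) * (?s\<^sup>2 + ?d\<^sup>2) = h / \<theta> * (((v k)\<^sup>2 + (v (Suc k))\<^sup>2) / 2)"
      using \<theta> by (simp add: power2_sum power2_diff field_simps)
    also have "\<theta> / h * ?d\<^sup>2 = \<theta> * h * (?d / h)\<^sup>2"
      using h by (simp add: power2_eq_square)
    finally show ?thesis
      .
  qed
  have main: "\<bar>(v m)\<^sup>2 - (v l)\<^sup>2\<bar> \<le> (\<Sum>k<N. ?b k)" if "l \<le> m" "m \<le> N" for l m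
  proof -
    have "(v m)\<^sup>2 - (v l)\<^sup>2 = (\<Sum>k = l..<m. (v (Suc k))\<^sup>2 - (v k)\<^sup>2)"
      using sum_Suc_diff'[of l m "\<lambda>k. (v k)\<^sup>2"] that by simp
    then have "\<bar>(v m)\<^sup>2 - (v l)\<^sup>2\<bar> \<le> (\<Sum>k = l..<m. \<bar>(v (Suc k))\<^sup>2 - (v k)\<^sup>2\<bar>)"
      by (simp add: sum_abs)
    also have "\<dots> \<le> (\<Sum>k = l..<m. ?b k)"
      by (rule sum_mono) (rule b)
    also have "\<dots> \<le> (\<Sum>k<N. ?b k)"
      by (rule sum_mono2) (use that h \<theta> in auto)
    finally show ?thesis .
  qed
  have "(v i)\<^sup>2 - (v j)\<^sup>2 \<le> (\<Sum>k<N. ?b k)"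
    using main[of i j] main[of j i] assms by (cases "i \<le> j") auto
  also have "\<dots> = \<theta> * (h * (\<Sum>i<N. ((v (Suc i) - v i) / h)\<^sup>2)) + grid_norm2 h N v / \<theta>"
    unfolding grid_norm2_eq_sum_midpoint[OF N] sum.distrib
    by (simp add: sum_distrib_left sum_divide_distrib mult_ac)
  finally show ?thesis by simp
qed

text \<open>Average the preceding bound over the reference node with trapezoidal weights; this
  produces the term with the interval length N h.\<close>

lemma grid_max_norm_power2_le:
  fixes v :: "nat \<Rightarrow> real"
  assumes h: "0 < h" and \<theta>: "0 < \<theta>" and N: "0 < N"
  shows "(grid_max_norm N v)\<^sup>2
    \<le> \<theta> * (h * (\<Sum>i<N. ((v (Suc i) - v i) / h)\<^sup>2)) + (1 / \<theta> + 1 / (N * h)) * grid_norm2 h N v"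
proof -
  let ?E = "\<theta> * (h * (\<Sum>i<N. ((v (Suc i) - v i) / h)\<^sup>2)) + grid_norm2 h N v / \<theta>"
  have "grid_max_norm N v \<in> (\<lambda>i. \<bar>v i\<bar>) ` {0..N}"
    unfolding grid_max_norm_def by (rule Max_in) auto
  then obtain i where i: "i \<le> N" "grid_max_norm N v = \<bar>v i\<bar>" by auto
  have "(\<Sum>j<N. (v i)\<^sup>2) \<le> (\<Sum>j<N. ((v j)\<^sup>2 + (v (Suc j))\<^sup>2) / 2 + ?E)"
  proof (rule sum_mono)
    fix j assume "j \<in> {..<N}"
    then have "(v i)\<^sup>2 \<le> (v j)\<^sup>2 + ?E" "(v i)\<^sup>2 \<le> (v (Suc j))\<^sup>2 + ?E"
      using grid_power2_diff_le[OF h \<theta> i(1) _ N, of j v] grid_power2_diff_le[OF h \<theta> i(1) _ N, of "Suc j" v]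
      by auto
    then show "(v i)\<^sup>2 \<le> ((v j)\<^sup>2 + (v (Suc j))\<^sup>2) / 2 + ?E" by argo
  qed
  then have "N * (v i)\<^sup>2 \<le> grid_norm2 h N v / h + N * ?E"
    unfolding sum.distrib[of _ "\<lambda>_. ?E"] using h by (simp add: grid_norm2_eq_sum_midpoint[OF N])
  then have "(v i)\<^sup>2 \<le> grid_norm2 h N v / (N * h) + ?E"
    using h N by (simp add: field_simps)
  then show ?thesis
    unfolding i(2) by (simp add: algebra_simps)
qed

text \<open>Discrete Green identity; its boundary fluxes are later cancelled by the boundary
  equations.\<close>

lemma trapezoid_by_parts:
  fixes a u v :: "nat \<Rightarrow> real"
  assumes h: "0 < h" and N: "0 < N"
  shows "h * (\<Sum>i = 1..N - 1. ((u (i + 1) - u i) / h - (u i - u (i - 1)) / h) / h * u i)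
    = - (h * (\<Sum>i<N. ((u (Suc i) - u i) / h)\<^sup>2)) - (u 1 - u 0) / h * u 0 + (u N - u (N - 1)) / h * u N"
proof -
  obtain m where m: "N = Suc m" using N gr0_implies_Suc by blast
  have "h * (\<Sum>i = 1..m. ((u (i + 1) - u i) / h - (u i - u (i - 1)) / h) / h * u i)
    = - (h * (\<Sum>i<Suc m. ((u (Suc i) - u i) / h)\<^sup>2)) - (u 1 - u 0) / h * u 0 + (u (Suc m) - u m) / h * u (Suc m)"
  proof (induction m)
    case 0
    show ?case using h by (simp add: power2_eq_square field_simps)
  next
    case (Suc m)
    let ?a = "u m" and ?b = "u (Suc m)" and ?c = "u (Suc (Suc m))"
    have "h * (((?c - ?b) / h - (?b - ?a) / h) / h * ?b)
      = - (h * ((?c - ?b) / h)\<^sup>2) + (?c - ?b) / h * ?c - (?b - ?a) / h * ?b"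
      using h by (simp add: power2_eq_square field_simps)
    moreover have "(\<Sum>i = 1..Suc m. ((u (i + 1) - u i) / h - (u i - u (i - 1)) / h) / h * u i)
      = (\<Sum>i = 1..m. ((u (i + 1) - u i) / h - (u i - u (i - 1)) / h) / h * u i)
        + ((?c - ?b) / h - (?b - ?a) / h) / h * ?b"
      by simp
    moreover have "(\<Sum>i<Suc (Suc m). ((u (Suc i) - u i) / h)\<^sup>2)
      = (\<Sum>i<Suc m. ((u (Suc i) - u i) / h)\<^sup>2) + ((?c - ?b) / h)\<^sup>2"
      by simp
    ultimately show ?case
      using Suc.IH by (simp only: distrib_left)
  qed
  then show ?thesis by (simp add: m)
qed

section \<open>The energy estimate\<close>

theorem theorem8:
  fixes \<alpha> xl xr T \<epsilon>0 :: real
    and NT NS NA :: nat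
    and sa wa sb wb :: "nat \<Rightarrow> real"
    and u f :: "nat \<Rightarrow> nat \<Rightarrow> real"
    and n :: nat
  defines "L \<equiv> xr - xl"
  defines "dt \<equiv> T / real NT"
  defines "h \<equiv> (xr - xl) / real NS"
  assumes alpha: "0 < \<alpha>" "\<alpha> < 1"
    and xlr: "xl < xr" and Tpos: "0 < T"
    and NTpos: "0 < NT" and NSpos: "0 < NS"
    and sa_pos: "\<And>i. 1 \<le> i \<Longrightarrow> i \<le> NA \<Longrightarrow> 0 < sa i"
    and wa_pos: "\<And>i. 1 \<le> i \<Longrightarrow> i \<le> NA \<Longrightarrow> 0 < wa i"
    and sb_pos: "\<And>i. 1 \<le> i \<Longrightarrow> i \<le> NA \<Longrightarrow> 0 < sb i"
    and wb_pos: "\<And>i. 1 \<le> i \<Longrightarrow> i \<le> NA \<Longrightarrow> 0 < wb i"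
    and approx_a: "\<And>t. dt \<le> t \<Longrightarrow> t \<le> T \<Longrightarrow>
        \<bar>t powr (- \<alpha>) - (\<Sum>i = 1..NA. wa i * exp (- sa i * t))\<bar> \<le> \<epsilon>0"
    and approx_b: "\<And>t. dt \<le> t \<Longrightarrow> t \<le> T \<Longrightarrow>
        \<bar>t powr (- (\<alpha>/2)) - (\<Sum>i = 1..NA. wb i * exp (- sb i * t))\<bar> \<le> \<epsilon>0"
    and interior: "\<And>i k. 1 \<le> i \<Longrightarrow> i \<le> NS - 1 \<Longrightarrow> 1 \<le> k \<Longrightarrow> k \<le> NT \<Longrightarrow>
        fidr \<alpha> dt NA wa sa (u i) k
          = ((u (i + 1) k - u i k) / h - (u i k - u (i - 1) k) / h) / h + f i k"
    and left: "\<And>k. 1 \<le> k \<Longrightarrow> k \<le> NT \<Longrightarrow>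
        fidr \<alpha> dt NA wa sa (u 0) k
          = (2 / h) * ((u 1 k - u 0 k) / h - fidr (\<alpha>/2) dt NA wb sb (u 0) k) + f 0 k"
    and right: "\<And>k. 1 \<le> k \<Longrightarrow> k \<le> NT \<Longrightarrow>
        fidr \<alpha> dt NA wa sa (u NS) k
          = (2 / h) * (- ((u NS k - u (NS - 1) k) / h) - fidr (\<alpha>/2) dt NA wb sb (u NS) k)
            + f NS k"
    and n: "1 \<le> n" "n \<le> NT"
    and mu_pos: "0 < ((real n * dt) powr (- \<alpha>) - \<epsilon>0) / Gamma (1 - \<alpha>)"
    and nu_pos: "0 < ((real n * dt) powr (- (\<alpha>/2)) - \<epsilon>0) / Gamma (1 - \<alpha>/2)"
  shows
    "let \<rho> = (dt powr (1 - \<alpha>) / (1 - \<alpha>) + ((real n - 1) * dt) * dt powr (- \<alpha>))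
               / (2 * Gamma (1 - \<alpha>));
         \<sigma> = (dt powr (1 - \<alpha>/2) / (1 - \<alpha>/2) + ((real n - 1) * dt) * dt powr (- (\<alpha>/2)))
               / (2 * Gamma (1 - \<alpha>/2));
         \<mu> = ((real n * dt) powr (- \<alpha>) - \<epsilon>0) / Gamma (1 - \<alpha>);
         \<nu> = ((real n * dt) powr (- (\<alpha>/2)) - \<epsilon>0) / Gamma (1 - \<alpha>/2)
     in dt * (\<Sum>k = 1..n. (grid_max_norm NS (\<lambda>i. u i k))^2)
        \<le> 2 * (1 + sqrt (1 + L^2 * \<mu>)) / (L * \<mu>) *
           (\<rho> * grid_norm2 h NS (\<lambda>i. u i 0)
            + \<sigma> * ((u 0 0)^2 + (u NS 0)^2)
            + dt / (8 * \<nu>) * (\<Sum>k = 1..n. (h * f 0 k)^2 + (h * f NS k)^2)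
            + dt / \<mu> * (\<Sum>k = 1..n. h * (\<Sum>i = 1..NS - 1. (f i k)^2)))"
proof -
  define \<rho> where "\<rho> = (dt powr (1 - \<alpha>) / (1 - \<alpha>) + ((real n - 1) * dt) * dt powr (- \<alpha>))
    / (2 * Gamma (1 - \<alpha>))"
  define \<sigma> where "\<sigma> = (dt powr (1 - \<alpha>/2) / (1 - \<alpha>/2) + ((real n - 1) * dt) * dt powr (- (\<alpha>/2)))
    / (2 * Gamma (1 - \<alpha>/2))"
  define \<mu> where "\<mu> = ((real n * dt) powr (- \<alpha>) - \<epsilon>0) / Gamma (1 - \<alpha>)"
  define \<nu> where "\<nu> = ((real n * dt) powr (- (\<alpha>/2)) - \<epsilon>0) / Gamma (1 - \<alpha>/2)"
  define Da where "Da i k = fidr \<alpha> dt NA wa sa (u i) k" for i k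
  define Db where "Db i k = fidr (\<alpha>/2) dt NA wb sb (u i) k" for i k
  define N where "N k = grid_norm2 h NS (\<lambda>i. u i k)" for k
  define E where "E k = h * (\<Sum>i<NS. ((u (Suc i) k - u i k) / h)\<^sup>2)" for k
  define FB where "FB k = (h * f 0 k)\<^sup>2 + (h * f NS k)\<^sup>2" for k
  define FI where "FI k = h * (\<Sum>i = 1..NS - 1. (f i k)\<^sup>2)" for k
  \<comment> \<open>The end weights h/2 match the factor 2/h in the boundary equations.\<close>
  define tz where "tz F = h * ((1/2) * F 0 + (\<Sum>i = 1..NS - 1. F i) + (1/2) * F NS)" for F :: "nat \<Rightarrow> real"
  define \<theta> where "\<theta> = 2 * (1 + sqrt (1 + L^2 * \<mu>)) / (L * \<mu>)"
  define R where "R = \<rho> * N 0 + \<sigma> * ((u 0 0)\<^sup>2 + (u NS 0)\<^sup>2)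
    + dt / (8 * \<nu>) * (\<Sum>k = 1..n. FB k) + dt / \<mu> * (\<Sum>k = 1..n. FI k)"
  have \<mu>: "0 < \<mu>" and \<nu>: "0 < \<nu>"
    using mu_pos nu_pos by (simp_all add: \<mu>_def \<nu>_def)
  have dt: "0 < dt" and h: "0 < h" and L: "0 < L" and Lh: "NS * h = L"
    using Tpos NTpos xlr NSpos by (simp_all add: dt_def h_def L_def)
  have "1 * dt \<le> n * dt" "n * dt \<le> NT * dt"
    using n dt by (intro mult_right_mono; simp)+
  then have t: "dt \<le> dt" "dt \<le> T" "dt \<le> n * dt" "n * dt \<le> T"
    using NTpos by (simp_all add: dt_def)

  have tz_mono: "tz F \<le> tz G" if "\<And>i. i \<le> NS \<Longrightarrow> F i \<le> G i" for F G
    unfolding tz_def using h that by (intro mult_left_mono add_mono sum_mono) auto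
  have tz_sum: "tz (\<lambda>i. dt * (\<Sum>k = 1..n. F i k)) = dt * (\<Sum>k = 1..n. tz (\<lambda>i. F i k))" for F
  proof -
    have "(\<Sum>k = 1..n. \<Sum>i = 1..NS - 1. F i k) = (\<Sum>i = 1..NS - 1. \<Sum>k = 1..n. F i k)"
      by (rule sum.swap)
    then show ?thesis
      unfolding tz_def sum_distrib_left[symmetric] sum.distrib by (simp add: algebra_simps)
  qed
  have tz_diff: "tz (\<lambda>i. a * F i - b * G i) = a * tz F - b * tz G" for a b F G
    unfolding tz_def sum_subtractf sum_distrib_left[symmetric] by (simp add: algebra_simps)
  have N_tz: "N k = tz (\<lambda>i. (u i k)\<^sup>2)" for k
    by (simp add: N_def tz_def grid_norm2_def)

  have Da: "\<mu> / 2 * (dt * (\<Sum>k = 1..n. (u i k)\<^sup>2)) - \<rho> * (u i 0)\<^sup>2 \<le> dt * (\<Sum>k = 1..n. Da i k * u i k)" for i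
    unfolding \<mu>_def \<rho>_def Da_def
    using approx_a[OF t(1,2)] approx_a[OF t(3,4)]
    by (intro fidr_coercive alpha dt n sa_pos wa_pos mu_pos) auto
  have Db: "\<nu> / 2 * (dt * (\<Sum>k = 1..n. (u i k)\<^sup>2)) - \<sigma> * (u i 0)\<^sup>2 \<le> dt * (\<Sum>k = 1..n. Db i k * u i k)" for i
    unfolding \<nu>_def \<sigma>_def Db_def
    using approx_b[OF t(1,2)] approx_b[OF t(3,4)] alpha
    by (intro fidr_coercive dt n sb_pos wb_pos nu_pos) auto

  \<comment> \<open>Testing with u^k cancels the boundary fluxes. In Young's inequality the boundary
    sources cost \<nu>/2, all that the coercivity of \<open>Db\<close> supplies; the interior
    sources cost \<mu>/4, half of what \<open>Da\<close> supplies.\<close>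
  have step: "tz (\<lambda>i. Da i k * u i k) \<le> \<mu> / 4 * N k - E k + FB k / (8 * \<nu>) + FI k / \<mu>
      + \<nu> / 2 * ((u 0 k)\<^sup>2 + (u NS k)\<^sup>2) - (Db 0 k * u 0 k + Db NS k * u NS k)"
    if k: "k \<in> {1..n}" for k
  proof -
    have k1: "1 \<le> k" "k \<le> NT" using k n by auto
    have "(\<Sum>i = 1..NS - 1. Da i k * u i k)
      = (\<Sum>i = 1..NS - 1. ((u (i + 1) k - u i k) / h - (u i k - u (i - 1) k) / h) / h * u i k + f i k * u i k)"
      by (rule sum.cong) (use interior k1 in \<open>auto simp: Da_def distrib_right\<close>)
    then have "h * (\<Sum>i = 1..NS - 1. Da i k * u i k) = - E k - (u 1 k - u 0 k) / h * u 0 k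
        + (u NS k - u (NS - 1) k) / h * u NS k + h * (\<Sum>i = 1..NS - 1. f i k * u i k)"
      using trapezoid_by_parts[OF h NSpos, of "\<lambda>i. u i k"]
      by (simp only: sum.distrib distrib_left E_def)
    moreover have "h / 2 * Da 0 k = (u 1 k - u 0 k) / h - Db 0 k + h * f 0 k / 2"
      using left[OF k1] h by (simp add: Da_def Db_def distrib_left)
    then have "h / 2 * (Da 0 k * u 0 k)
        = (u 1 k - u 0 k) / h * u 0 k - Db 0 k * u 0 k + (h * f 0 k) * u 0 k / 2"
      unfolding mult.assoc[symmetric] by (simp add: left_diff_distrib distrib_right)
    moreover have "h / 2 * Da NS k = - ((u NS k - u (NS - 1) k) / h) - Db NS k + h * f NS k / 2"
      using right[OF k1] h by (simp add: Da_def Db_def distrib_left)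
    then have "h / 2 * (Da NS k * u NS k)
        = - ((u NS k - u (NS - 1) k) / h * u NS k) - Db NS k * u NS k + (h * f NS k) * u NS k / 2"
      unfolding mult.assoc[symmetric] by (simp add: left_diff_distrib distrib_right)
    moreover have "tz (\<lambda>i. Da i k * u i k) = h / 2 * (Da 0 k * u 0 k)
        + h * (\<Sum>i = 1..NS - 1. Da i k * u i k) + h / 2 * (Da NS k * u NS k)"
      by (simp add: tz_def algebra_simps)
    ultimately have "tz (\<lambda>i. Da i k * u i k) = - E k - (Db 0 k * u 0 k + Db NS k * u NS k)
        + h * (\<Sum>i = 1..NS - 1. f i k * u i k) + (h * f 0 k) * u 0 k / 2 + (h * f NS k) * u NS k / 2"
      by linarith
    moreover have "a * b / 2 \<le> \<nu> / 2 * b\<^sup>2 + a\<^sup>2 / (8 * \<nu>)" for a b :: real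
    proof -
      have "0 \<le> (2 * \<nu> * b - a)\<^sup>2 / (8 * \<nu>)" using \<nu> by simp
      also have "\<dots> = \<nu> / 2 * b\<^sup>2 + a\<^sup>2 / (8 * \<nu>) - a * b / 2"
        using \<nu> by (simp add: power2_eq_square field_simps)
      finally show ?thesis by simp
    qed
    note this[of "h * f 0 k" "u 0 k"] this[of "h * f NS k" "u NS k"]
    moreover have "h * (\<Sum>i = 1..NS - 1. f i k * u i k) \<le> \<mu> / 4 * N k + FI k / \<mu>"
    proof -
      have "a * b \<le> \<mu> / 4 * b\<^sup>2 + a\<^sup>2 / \<mu>" for a b :: real
      proof -
        have "0 \<le> (\<mu> / 2 * b - a)\<^sup>2 / \<mu>" using \<mu> by simp
        also have "\<dots> = \<mu> / 4 * b\<^sup>2 + a\<^sup>2 / \<mu> - a * b"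
          using \<mu> by (simp add: power2_eq_square field_simps)
        finally show ?thesis by simp
      qed
      then have "h * (\<Sum>i = 1..NS - 1. f i k * u i k)
        \<le> h * (\<Sum>i = 1..NS - 1. \<mu> / 4 * (u i k)\<^sup>2 + (f i k)\<^sup>2 / \<mu>)"
        using h by (intro mult_left_mono sum_mono) auto
      also have "\<dots> = \<mu> / 4 * (h * (\<Sum>i = 1..NS - 1. (u i k)\<^sup>2)) + FI k / \<mu>"
        by (simp add: FI_def sum.distrib distrib_left flip: sum_distrib_left sum_divide_distrib)
      also have "\<dots> \<le> \<mu> / 4 * N k + FI k / \<mu>"
        unfolding N_def using h \<mu>
        by (intro add_right_mono mult_left_mono sum_interior_power2_le_grid_norm2) auto
      finally show ?thesis .
    qed
    ultimately show ?thesis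
      unfolding FB_def by (simp add: add_divide_distrib distrib_left)
  qed

  have "\<mu> / 2 * (dt * (\<Sum>k = 1..n. N k)) - \<rho> * N 0
      = tz (\<lambda>i. \<mu> / 2 * (dt * (\<Sum>k = 1..n. (u i k)\<^sup>2)) - \<rho> * (u i 0)\<^sup>2)"
    by (simp only: N_tz tz_diff tz_sum)
  also have "\<dots> \<le> tz (\<lambda>i. dt * (\<Sum>k = 1..n. Da i k * u i k))"
    by (rule tz_mono) (rule Da)
  also have "\<dots> = dt * (\<Sum>k = 1..n. tz (\<lambda>i. Da i k * u i k))"
    by (rule tz_sum)
  also have "\<dots> \<le> dt * (\<Sum>k = 1..n. \<mu> / 4 * N k - E k + FB k / (8 * \<nu>) + FI k / \<mu>
      + \<nu> / 2 * ((u 0 k)\<^sup>2 + (u NS k)\<^sup>2) - (Db 0 k * u 0 k + Db NS k * u NS k))"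
    using dt by (intro mult_left_mono sum_mono step) auto
  also have "\<dots> = \<mu> / 4 * (dt * (\<Sum>k = 1..n. N k)) - dt * (\<Sum>k = 1..n. E k)
      + dt / (8 * \<nu>) * (\<Sum>k = 1..n. FB k) + dt / \<mu> * (\<Sum>k = 1..n. FI k)
      + (\<nu> / 2 * (dt * (\<Sum>k = 1..n. (u 0 k)\<^sup>2)) - dt * (\<Sum>k = 1..n. Db 0 k * u 0 k))
      + (\<nu> / 2 * (dt * (\<Sum>k = 1..n. (u NS k)\<^sup>2)) - dt * (\<Sum>k = 1..n. Db NS k * u NS k))"
    unfolding sum.distrib sum_subtractf sum_distrib_left[symmetric] sum_divide_distrib[symmetric]
    by (simp add: algebra_simps)
  finally have energy: "\<mu> / 4 * (dt * (\<Sum>k = 1..n. N k)) + dt * (\<Sum>k = 1..n. E k) \<le> R"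
    using Db[of 0] Db[of NS] unfolding R_def distrib_left[of \<sigma>] by linarith

  define s where "s = sqrt (1 + L^2 * \<mu>)"
  have s: "0 < s" "s\<^sup>2 = 1 + L^2 * \<mu>"
    using \<mu> by (simp_all add: s_def add_pos_nonneg)
  have \<theta>_s: "\<theta> = 2 * (1 + s) / (L * \<mu>)"
    by (simp add: \<theta>_def s_def)
  have \<theta>: "0 < \<theta>"
    using s(1) L \<mu> by (simp add: \<theta>_s)
  \<comment> \<open>\<theta> is the positive root of this equation, so the Sobolev bound becomes
    exactly \<theta> times the left side of \<open>energy\<close>.\<close>
  have \<theta>_eq: "1 / \<theta> + 1 / L = \<theta> * (\<mu> / 4)"
  proof -
    have "L * \<mu> * (2 * L) = (s - 1) * (2 * (1 + s))"
      using s(2) by (simp add: algebra_simps power2_eq_square)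
    then have inv: "1 / \<theta> = (s - 1) / (2 * L)"
      unfolding \<theta>_s using s(1) L by (simp add: frac_eq_eq)
    have "1 / \<theta> + 1 / L = (1 + s) / (2 * L)"
      unfolding inv using L by (simp add: field_simps)
    also have "\<dots> = \<theta> * (\<mu> / 4)"
      using L \<mu> by (simp add: \<theta>_s frac_eq_eq algebra_simps)
    finally show ?thesis .
  qed
  have "dt * (\<Sum>k = 1..n. (grid_max_norm NS (\<lambda>i. u i k))^2)
      \<le> dt * (\<Sum>k = 1..n. \<theta> * E k + (1 / \<theta> + 1 / L) * N k)"
    using grid_max_norm_power2_le[OF h \<theta> NSpos] dt unfolding E_def N_def Lh
    by (intro mult_left_mono sum_mono) auto
  also have "\<dots> = \<theta> * (\<mu> / 4 * (dt * (\<Sum>k = 1..n. N k)) + dt * (\<Sum>k = 1..n. E k))"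
    unfolding \<theta>_eq sum.distrib sum_distrib_left[symmetric] by (simp add: algebra_simps)
  also have "\<dots> \<le> \<theta> * R"
    using energy \<theta> by (intro mult_left_mono) auto
  finally show ?thesis
    unfolding Let_def \<theta>_def R_def \<rho>_def \<sigma>_def \<mu>_def \<nu>_def N_def FB_def FI_def .
qed

end
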